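(* Let $U\subset\subset\widetilde U$ be open subsets of $\mathbb R^n$, let $\check F:\widetilde U\times\mathbb R^n\to\mathbb R$ be a smooth family of asymmetric norms and let $F:\widetilde U\times\mathbb R^n\to\mathbb R$ be a horizontally $C^2$ family of strongly convex asymmetric norms with respect to $\check F$ such that $d_hF^2:\widetilde U\times\mathbb R^n\to\mathbb R^{n*}$ is locally Lipschitz. Then $$d_v{F_*}^2:U\times\mathbb R^{n*}\to\mathbb R^n$$ is locally Lipschitz.
   Context: $U\subset\subset\widetilde U$ means that $\bar U$ is compact and $\bar U\subset\widetilde U$. An asymmetric norm on a finite dimensional real vector space $V$ is a function $F:V\to[0,\infty)$ with $F(y)=0$ iff $y=0$, $F(\lambda y)=\lambda F(y)$ for $\lambda>0$, and $F(y_1+y_2)\le F(y_1)+F(y_2)$. For $W\subset\mathbb R^n$ open: a continuous $F:W\times\mathbb R^n\to\mathbb R$ is a horizontally $C^1$ family of asymmetric norms if every $F(x,\cdot)$ is an asymmetric norm and $(x,y)\mapsto\frac{\partial F}{\partial x^i}(x,y)$ is continuous for $i=1,\dots,n$. It is a horizontally $C^2$ family if moreover $\frac{\partial^2F}{\partial x^i\partial x^j}:W\times(\mathbb R^n\backslash\{0\})\to\mathbb R$ is continuous for all $i,j$. A smooth family of asymmetric norms is a map $\check F:W\times\mathbb R^n\to\mathbb R$ that is $C^\infty$ on $W\times(\mathbb R^n\backslash\{0\})$ and such that each $\check F(x,\cdot)$ is an asymmetric norm. $F$ is strongly convex with respect to $\check F$ if $F^2(x,z)\ge F^2(x,y)+\alpha(z-y)+\check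 F^2(x,z-y)$ for all $x\in W$, $y,z\in\mathbb R^n$ and all $\alpha\in\partial F^2(x,y)$, where $\partial F^2(x,y)$ is the subdifferential of the convex function $F(x,\cdot)^2$ at $y$. $d_hF^2(x,y)=\sum_i\frac{\partial F^2}{\partial x^i}(x,y)\,dx^i\in\mathbb R^{n*}$ is the horizontal differential. $F_*(x,\alpha)=\sup_{F(x,y)\le1}\alpha(y)$ for $\alpha\in\mathbb R^{n*}$ is the family of dual asymmetric norms. For strictly convex $F(x,\cdot)$ the function ${F_*}^2(x,\cdot)$ is differentiable, and $d_v{F_*}^2(x,\alpha)\in(\mathbb R^{n*})^*\cong\mathbb R^n$ denotes its differential at $\alpha$ ($x$ fixed). *)

theory Defs
  imports "HOL-Analysis.Analysis"
begin

definition compactly_contained :: "'a::topological_space set \<Rightarrow> 'a set \<Rightarrow> bool" where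
  "compactly_contained U V \<longleftrightarrow> compact (closure U) \<and> closure U \<subseteq> V"

definition asymmetric_norm :: "('a::real_vector \<Rightarrow> real) \<Rightarrow> bool" where
  "asymmetric_norm N \<longleftrightarrow>
     (\<forall>y. N y \<ge> 0) \<and>
     (\<forall>y. N y = 0 \<longleftrightarrow> y = 0) \<and>
     (\<forall>c>0. \<forall>y. N (c *\<^sub>R y) = c * N y) \<and>
     (\<forall>y z. N (y + z) \<le> N y + N z)"

definition locally_lipschitz_on :: "'a::metric_space set \<Rightarrow> ('a \<Rightarrow> 'b::metric_space) \<Rightarrow> bool" where
  "locally_lipschitz_on S f \<longleftrightarrow>
     (\<forall>p\<in>S. \<exists>e>0. \<exists>L. L-lipschitz_on (ball p e \<inter> S) f)"

text \<open>\<^term>\<open>deriv\<close> is a total function, so wherever the following partial derivatives are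
  required to be continuous, their existence is required separately.\<close>

definition partial_exists :: "('a::real_vector \<Rightarrow> real) \<Rightarrow> 'a \<Rightarrow> 'a \<Rightarrow> bool" where
  "partial_exists f b p \<longleftrightarrow> (\<lambda>t::real. f (p + t *\<^sub>R b)) field_differentiable (at 0)"

definition partial :: "('a::real_vector \<Rightarrow> real) \<Rightarrow> 'a \<Rightarrow> 'a \<Rightarrow> real" where
  "partial f b p = deriv (\<lambda>t::real. f (p + t *\<^sub>R b)) 0"

text \<open>Being of class \<open>C\<^sup>k\<close> on an open set: all iterated partial derivatives of order at most
  \<open>k\<close> exist and are continuous.\<close>

primrec Ck_on :: "nat \<Rightarrow> 'a::euclidean_space set \<Rightarrow> ('a \<Rightarrow> real) \<Rightarrow> bool" where
  "Ck_on 0 S f \<longleftrightarrow> continuous_on S f"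
| "Ck_on (Suc k) S f \<longleftrightarrow> continuous_on S f \<and>
     (\<forall>b\<in>Basis. (\<forall>p\<in>S. partial_exists f b p) \<and> Ck_on k S (partial f b))"

definition Cinf_on :: "'a::euclidean_space set \<Rightarrow> ('a \<Rightarrow> real) \<Rightarrow> bool" where
  "Cinf_on S f \<longleftrightarrow> (\<forall>k. Ck_on k S f)"

text \<open>Families on \<open>W \<times> \<real>\<^sup>n\<close> are curried total functions; only their values at base points
  in \<open>W\<close> matter. \<open>hpartial i F x y\<close> is the derivative of \<open>F\<close> with respect to the
  \<open>i\<close>-th coordinate of \<open>x\<close>, with \<open>y\<close> fixed.\<close>

definition hpartial_exists ::
    "'n::finite \<Rightarrow> (real ^ 'n \<Rightarrow> real ^ 'n \<Rightarrow> real) \<Rightarrow> real ^ 'n \<Rightarrow> real ^ 'n \<Rightarrow> bool" where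
  "hpartial_exists i F x y \<longleftrightarrow> partial_exists (\<lambda>u. F u y) (axis i 1) x"

definition hpartial ::
    "'n::finite \<Rightarrow> (real ^ 'n \<Rightarrow> real ^ 'n \<Rightarrow> real) \<Rightarrow> real ^ 'n \<Rightarrow> real ^ 'n \<Rightarrow> real" where
  "hpartial i F x y = partial (\<lambda>u. F u y) (axis i 1) x"

definition horizontally_C1_family ::
    "(real ^ 'n::finite) set \<Rightarrow> (real ^ 'n \<Rightarrow> real ^ 'n \<Rightarrow> real) \<Rightarrow> bool" where
  "horizontally_C1_family W F \<longleftrightarrow>
     continuous_on (W \<times> UNIV) (\<lambda>(x, y). F x y) \<and>
     (\<forall>x\<in>W. asymmetric_norm (F x)) \<and>
     (\<forall>i. (\<forall>x\<in>W. \<forall>y. hpartial_exists i F x y) \<and>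
          continuous_on (W \<times> UNIV) (\<lambda>(x, y). hpartial i F x y))"

definition horizontally_C2_family ::
    "(real ^ 'n::finite) set \<Rightarrow> (real ^ 'n \<Rightarrow> real ^ 'n \<Rightarrow> real) \<Rightarrow> bool" where
  "horizontally_C2_family W F \<longleftrightarrow>
     horizontally_C1_family W F \<and>
     (\<forall>i j. (\<forall>x\<in>W. \<forall>y\<in>UNIV - {0}. hpartial_exists i (hpartial j F) x y) \<and>
            continuous_on (W \<times> (UNIV - {0})) (\<lambda>(x, y). hpartial i (hpartial j F) x y))"

definition smooth_family ::
    "(real ^ 'n::finite) set \<Rightarrow> (real ^ 'n \<Rightarrow> real ^ 'n \<Rightarrow> real) \<Rightarrow> bool" where
  "smooth_family W F \<longleftrightarrow>
     Cinf_on (W \<times> (UNIV - {0})) (\<lambda>(x, y). F x y) \<and>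
     (\<forall>x\<in>W. asymmetric_norm (F x))"

text \<open>The dual space \<open>\<real>\<^sup>n\<^sup>*\<close> is the space of bounded linear functionals, with the operator norm.\<close>

definition subdifferential ::
    "('a::real_normed_vector \<Rightarrow> real) \<Rightarrow> 'a \<Rightarrow> ('a \<Rightarrow>\<^sub>L real) set" where
  "subdifferential g y = {\<alpha>. \<forall>z. g z \<ge> g y + blinfun_apply \<alpha> (z - y)}"

definition strongly_convex_wrt ::
    "(real ^ 'n::finite) set \<Rightarrow> (real ^ 'n \<Rightarrow> real ^ 'n \<Rightarrow> real)
      \<Rightarrow> (real ^ 'n \<Rightarrow> real ^ 'n \<Rightarrow> real) \<Rightarrow> bool" where
  "strongly_convex_wrt W F F' \<longleftrightarrow>
     (\<forall>x\<in>W. \<forall>y z. \<forall>\<alpha>\<in>subdifferential (\<lambda>v. (F x v)\<^sup>2) y.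
        (F x z)\<^sup>2 \<ge> (F x y)\<^sup>2 + blinfun_apply \<alpha> (z - y) + (F' x (z - y))\<^sup>2)"

definition d_h ::
    "(real ^ 'n::finite \<Rightarrow> real ^ 'n \<Rightarrow> real) \<Rightarrow> real ^ 'n \<Rightarrow> real ^ 'n \<Rightarrow> (real ^ 'n) \<Rightarrow>\<^sub>L real" where
  "d_h G x y = (\<Sum>i\<in>UNIV. hpartial i G x y *\<^sub>R blinfun_inner_right (axis i 1))"

definition dual_family ::
    "('b \<Rightarrow> 'a::real_normed_vector \<Rightarrow> real) \<Rightarrow> 'b \<Rightarrow> ('a \<Rightarrow>\<^sub>L real) \<Rightarrow> real" where
  "dual_family F x \<alpha> = (SUP y\<in>{y. F x y \<le> 1}. blinfun_apply \<alpha> y)"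

text \<open>The differential at \<open>\<alpha>\<close> of a function on the dual space is an element of the bidual;
  \<open>d_v\<close> is the vector representing it under the canonical identification
  \<open>v \<mapsto> (\<beta> \<mapsto> \<beta> v)\<close>. It is meaningful only where \<open>G x\<close> is differentiable.\<close>

definition d_v ::
    "('b \<Rightarrow> ('a::euclidean_space \<Rightarrow>\<^sub>L real) \<Rightarrow> real) \<Rightarrow> 'b \<Rightarrow> ('a \<Rightarrow>\<^sub>L real) \<Rightarrow> 'a" where
  "d_v G x \<alpha> = (THE v. (G x has_derivative (\<lambda>\<beta>. blinfun_apply \<beta> v)) (at \<alpha>))"

end

(* The supremum of \<alpha>(y) - F\<^sup>2(x,y) over y is attained at a unique point y(x,\<alpha>), characterised by
   \<alpha> \<in> \<partial>F\<^sup>2(x,y), and homogeneity gives F\<^sub>*\<^sup>2(x,\<alpha>) = 4 (\<alpha>(y) - F\<^sup>2(x,y)). Hence d\<^sub>v F\<^sub>*\<^sup>2 = 4 y(x,\<alpha>).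
   Writing the strong convexity inequality at y\<^sub>1 = y(x\<^sub>1,\<alpha>\<^sub>1) and at y\<^sub>2 = y(x\<^sub>2,\<alpha>\<^sub>2) and adding, the
   increment in x of F\<^sup>2(x,y\<^sub>2) - F\<^sup>2(x,y\<^sub>1) bounds
   2 c |y\<^sub>2 - y\<^sub>1|\<^sup>2 - |\<alpha>\<^sub>1 - \<alpha>\<^sub>2| |y\<^sub>2 - y\<^sub>1| from above. By the Lipschitz condition on d\<^sub>h F\<^sup>2 this
   increment is at most a constant times |x\<^sub>1 - x\<^sub>2| |y\<^sub>2 - y\<^sub>1|; dividing by |y\<^sub>2 - y\<^sub>1| finishes. *)

theory Submission
  imports Defs
begin

section \<open>Asymmetric norms and their duals\<close>

text \<open>A continuous function attains its minimum on the compact set of base points in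
  \<open>K\<close> and unit vectors; the minimum is positive by definiteness and extends to all y by
  homogeneity. Continuity is asked for only away from y = 0, which is where a smooth family provides
  it.\<close>

lemma asymmetric_norm_lower_bound:
  fixes F :: "'b::topological_space \<Rightarrow> 'a::euclidean_space \<Rightarrow> real"
  assumes "compact K" and norm: "\<And>x. x \<in> K \<Longrightarrow> asymmetric_norm (F x)"
    and cont: "continuous_on (K \<times> (UNIV - {0})) (\<lambda>(x, y). F x y)"
  obtains m where "m > 0" and "\<And>x y. x \<in> K \<Longrightarrow> m * norm y \<le> F x y"
proof (cases "K = {}")
  case True
  show ?thesis by (rule that[of 1]) (use True in auto)
next
  case False
  let ?S = "K \<times> sphere (0::'a) 1"
  have "continuous_on ?S (\<lambda>(x, y). F x y)"
    by (rule continuous_on_subset[OF cont]) auto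
  moreover have "compact ?S" "?S \<noteq> {}"
    using \<open>compact K\<close> False by (auto intro: compact_Times)
  ultimately obtain p where p: "p \<in> ?S" "\<And>q. q \<in> ?S \<Longrightarrow> (\<lambda>(x, y). F x y) p \<le> (\<lambda>(x, y). F x y) q"
    using continuous_attains_inf by metis
  obtain x0 y0 where xy0: "p = (x0, y0)" "x0 \<in> K" "norm y0 = 1"
    using p(1) by auto
  show ?thesis
  proof (rule that)
    have "y0 \<noteq> 0" using xy0(3) by auto
    then show "F x0 y0 > 0"
      using norm[OF xy0(2)] unfolding asymmetric_norm_def by (metis less_eq_real_def)
  next
    fix x y assume x: "x \<in> K"
    show "F x0 y0 * norm y \<le> F x y"
    proof (cases "y = 0")
      case True
      then show ?thesis using norm[OF x] by (simp add: asymmetric_norm_def)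
    next
      case y: False
      have "F x0 y0 \<le> F x (y /\<^sub>R norm y)"
        using p(2)[of "(x, y /\<^sub>R norm y)"] x y xy0(1) by simp
      moreover have "F x y = norm y * F x (y /\<^sub>R norm y)"
      proof -
        have "y = norm y *\<^sub>R (y /\<^sub>R norm y)" using y by simp
        then show ?thesis
          using norm[OF x] y unfolding asymmetric_norm_def by (metis zero_less_norm_iff)
      qed
      ultimately show ?thesis
        by (simp add: mult.commute mult_left_mono)
    qed
  qed
qed

text \<open>A subgradient \<alpha> of N^2 at y is the same thing as a global maximum of \<alpha> -
  N^2 at y. Quadratic growth of N^2 confines the search for a maximum to a compact ball.\<close>

lemma subdifferential_square_surj:
  fixes N :: "'a::euclidean_space \<Rightarrow> real"
  assumes "continuous_on UNIV N" and "m > 0" and lower: "\<And>y. m * norm y \<le> N y" and N0: "N 0 = 0"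
  obtains y where "\<alpha> \<in> subdifferential (\<lambda>v. (N v)\<^sup>2) y"
proof -
  \<comment> \<open>Beyond this radius m^2 |z|^2 exceeds |\<alpha>| |z|, so \<alpha>(z) - N(z)^2
    falls to at most 0, its value at the origin.\<close>
  define R where "R = norm \<alpha> / m\<^sup>2"
  have "R \<ge> 0" by (simp add: R_def)
  have "continuous_on (cball 0 R) (\<lambda>y. blinfun_apply \<alpha> y - (N y)\<^sup>2)"
    by (intro continuous_intros continuous_on_subset[OF assms(1)]) auto
  from continuous_attains_sup[OF compact_cball _ this] \<open>R \<ge> 0\<close>
  obtain y where y: "y \<in> cball 0 R"
      "\<And>z. z \<in> cball 0 R \<Longrightarrow> blinfun_apply \<alpha> z - (N z)\<^sup>2 \<le> blinfun_apply \<alpha> y - (N y)\<^sup>2"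
    by force
  have "blinfun_apply \<alpha> z - (N z)\<^sup>2 \<le> blinfun_apply \<alpha> y - (N y)\<^sup>2" for z
  proof (cases "norm z \<le> R")
    case True
    then show ?thesis using y(2) by simp
  next
    case False
    then have "norm \<alpha> < m\<^sup>2 * norm z"
      using \<open>m > 0\<close> by (simp add: R_def field_simps)
    then have "norm \<alpha> * norm z \<le> (m\<^sup>2 * norm z) * norm z"
      by (intro mult_right_mono) auto
    also have "\<dots> = (m * norm z)\<^sup>2"
      by (simp add: power2_eq_square)
    also have "\<dots> \<le> (N z)\<^sup>2"
      using lower \<open>m > 0\<close> by (intro power_mono) auto
    finally have "blinfun_apply \<alpha> z - (N z)\<^sup>2 \<le> 0"
      using norm_blinfun[of \<alpha> z] by simp
    also have "0 \<le> blinfun_apply \<alpha> y - (N y)\<^sup>2"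
      using y(2)[of 0] \<open>R \<ge> 0\<close> N0 by simp
    finally show ?thesis .
  qed
  then have "\<alpha> \<in> subdifferential (\<lambda>v. (N v)\<^sup>2) y"
    by (simp add: subdifferential_def blinfun.diff_right algebra_simps)
  then show ?thesis by (rule that)
qed

text \<open>Euler's relation for the 2-homogeneous function N^2, without differentiability of N:
  along the ray through y, \<alpha> - N^2 is a quadratic polynomial in t with a local maximum at t =
  1, so its derivative vanishes there.\<close>

lemma subdifferential_square_homogeneous:
  assumes N: "asymmetric_norm N" and sub: "\<alpha> \<in> subdifferential (\<lambda>v. (N v)\<^sup>2) y"
  shows "blinfun_apply \<alpha> y = 2 * (N y)\<^sup>2"
proof -
  let ?h = "\<lambda>t. t * blinfun_apply \<alpha> y - t\<^sup>2 * (N y)\<^sup>2"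
  \<comment> \<open>The radius 1 around t = 1 keeps t positive, as positive homogeneity
    requires.\<close>
  have max: "?h t \<le> ?h 1" if "\<bar>1 - t\<bar> < 1" for t
  proof -
    have "t > 0" using that by auto
    then have "N (t *\<^sub>R y) = t * N y"
      using N by (simp add: asymmetric_norm_def)
    then show ?thesis
      using sub[unfolded subdifferential_def, simplified, rule_format, of "t *\<^sub>R y"]
      by (simp add: blinfun.diff_right blinfun.scaleR_right power_mult_distrib)
  qed
  have "(?h has_real_derivative blinfun_apply \<alpha> y - 2 * (N y)\<^sup>2) (at 1)"
    by (auto intro!: derivative_eq_intros)
  from DERIV_local_max[OF this zero_less_one] max show ?thesis
    by auto
qed

text \<open>The dual norm of \<alpha> is 2 F(x,y): comparing y with the competitors t z bounds it
  from above, and y / F(x,y) attains the bound. Euler's relation then turns 4 F^2 into the maximal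
  value of \<alpha> - F^2, the form suited to differentiating in \<alpha>.\<close>

lemma dual_square_eq:
  assumes N: "asymmetric_norm (F x)" and sub: "\<alpha> \<in> subdifferential (\<lambda>v. (F x v)\<^sup>2) y"
  shows "(dual_family F x \<alpha>)\<^sup>2 = 4 * (blinfun_apply \<alpha> y - (F x y)\<^sup>2)"
proof -
  have \<alpha>y: "blinfun_apply \<alpha> y = 2 * (F x y)\<^sup>2"
    using subdifferential_square_homogeneous[OF N sub] .
  have hom: "F x (t *\<^sub>R z) = t * F x z" if "t > 0" for t z
    using N that by (simp add: asymmetric_norm_def)
  have nonneg: "F x z \<ge> 0" for z
    using N by (simp add: asymmetric_norm_def)
  have zero: "F x z = 0 \<longleftrightarrow> z = 0" for z
    using N by (simp add: asymmetric_norm_def)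
  have opt: "t * blinfun_apply \<alpha> z \<le> (F x y)\<^sup>2 + t\<^sup>2" if "t > 0" "F x z \<le> 1" for t z
  proof -
    have "t * blinfun_apply \<alpha> z - t\<^sup>2 * (F x z)\<^sup>2 \<le> (F x y)\<^sup>2"
      using sub[unfolded subdifferential_def, simplified, rule_format, of "t *\<^sub>R z"] \<alpha>y
      by (simp add: hom[OF \<open>t > 0\<close>] blinfun.diff_right blinfun.scaleR_right power_mult_distrib)
    moreover have "t\<^sup>2 * (F x z)\<^sup>2 \<le> t\<^sup>2 * 1"
      using that nonneg by (intro mult_left_mono power_le_one) auto
    ultimately show ?thesis by simp
  qed
  have "dual_family F x \<alpha> = 2 * F x y"
    unfolding dual_family_def
  proof (rule cSup_eq)
    fix a assume "a \<in> blinfun_apply \<alpha> ` {y. F x y \<le> 1}"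
    then obtain z where z: "F x z \<le> 1" "a = blinfun_apply \<alpha> z" by auto
    show "a \<le> 2 * F x y"
    proof (cases "F x y = 0")
      case True
      \<comment> \<open>Here \<open>opt\<close> reads e a \<le> e^2; divide by e and let e tend to
        0.\<close>
      have "a \<le> e" if "e > 0" for e
        using opt[OF that z(1)] z(2) True that by (simp add: power2_eq_square)
      then show ?thesis using True by (simp add: field_le_epsilon)
    next
      case False
      then have pos: "F x y > 0" using nonneg[of y] by simp
      \<comment> \<open>The choice t = F(x,y) optimises the bound \<open>opt\<close>.\<close>
      have "F x y * a \<le> F x y * (2 * F x y)"
        using opt[OF pos z(1)] z(2) by (simp add: power2_eq_square)
      then show ?thesis using pos by simp
    qed
  next
    fix b assume ub: "\<And>a. a \<in> blinfun_apply \<alpha> ` {y. F x y \<le> 1} \<Longrightarrow> a \<le> b"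
    show "2 * F x y \<le> b"
    proof (cases "F x y = 0")
      case True
      then show ?thesis using ub[of 0] zero[of 0] by (force simp: image_iff intro: exI[of _ 0])
    next
      case False
      then have pos: "F x y > 0" using nonneg[of y] by simp
      have "F x (y /\<^sub>R F x y) = 1" using hom[of "inverse (F x y)" y] pos by simp
      then have "blinfun_apply \<alpha> (y /\<^sub>R F x y) \<le> b" by (intro ub) auto
      then show ?thesis
        using pos \<alpha>y by (simp add: blinfun.scaleR_right power2_eq_square field_simps)
    qed
  qed
  then show ?thesis by (simp add: \<alpha>y power_mult_distrib)
qed

section \<open>Consequences of strong convexity\<close>

text \<open>The Euclidean norm replaces the family \<open>F'\<close>, so that one constant can serve
  all base points of a compact set.\<close>

definition strongly_convex_at_rate :: "real \<Rightarrow> ('a::real_normed_vector \<Rightarrow> real) \<Rightarrow> bool" where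
  "strongly_convex_at_rate c g \<longleftrightarrow> (\<forall>y z. \<forall>\<alpha>\<in>subdifferential g y.
     g z \<ge> g y + blinfun_apply \<alpha> (z - y) + c * (norm (z - y))\<^sup>2)"

lemma strongly_convex_at_rateD:
  "strongly_convex_at_rate c g \<Longrightarrow> \<alpha> \<in> subdifferential g y \<Longrightarrow>
     g z \<ge> g y + blinfun_apply \<alpha> (z - y) + c * (norm (z - y))\<^sup>2"
  by (auto simp: strongly_convex_at_rate_def)

text \<open>Quantitative monotonicity of subgradients: add the inequality for \<open>g1\<close> from
  \<open>y1\<close> to \<open>y2\<close> and that for \<open>g2\<close> from \<open>y2\<close> to
  \<open>y1\<close>, then divide by |y2 - y1|. The case g1 = g2, B = 0 serves differentiability of
  the dual; different functions serve a change of base point.\<close>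

lemma strongly_convex_subgradient_distance:
  assumes "c > 0"
    and "strongly_convex_at_rate c g1" and "\<alpha>1 \<in> subdifferential g1 y1"
    and "strongly_convex_at_rate c g2" and "\<alpha>2 \<in> subdifferential g2 y2"
    and diff: "\<bar>(g1 y2 - g1 y1) - (g2 y2 - g2 y1)\<bar> \<le> B * norm (y2 - y1)" and "B \<ge> 0"
  shows "norm (y2 - y1) \<le> (B + norm (\<alpha>1 - \<alpha>2)) / (2 * c)"
proof (cases "y2 = y1")
  case True
  then show ?thesis using \<open>c > 0\<close> \<open>B \<ge> 0\<close> by simp
next
  case False
  have "blinfun_apply (\<alpha>2 - \<alpha>1) (y2 - y1) \<le> norm (\<alpha>2 - \<alpha>1) * norm (y2 - y1)"
    using norm_blinfun[of "\<alpha>2 - \<alpha>1" "y2 - y1"] by simp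
  moreover have "blinfun_apply (\<alpha>2 - \<alpha>1) (y2 - y1)
      = - blinfun_apply \<alpha>1 (y2 - y1) - blinfun_apply \<alpha>2 (y1 - y2)"
    by (simp add: blinfun.diff_left blinfun.diff_right)
  moreover have "g1 y2 \<ge> g1 y1 + blinfun_apply \<alpha>1 (y2 - y1) + c * (norm (y2 - y1))\<^sup>2"
    using assms by (intro strongly_convex_at_rateD)
  moreover have "g2 y1 \<ge> g2 y2 + blinfun_apply \<alpha>2 (y1 - y2) + c * (norm (y2 - y1))\<^sup>2"
    using strongly_convex_at_rateD[OF assms(4,5), of y1] by (simp add: norm_minus_commute)
  ultimately have "2 * c * (norm (y2 - y1))\<^sup>2 \<le> (B + norm (\<alpha>1 - \<alpha>2)) * norm (y2 - y1)"
    using diff by (simp add: norm_minus_commute algebra_simps abs_le_iff)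
  then have "2 * c * norm (y2 - y1) \<le> B + norm (\<alpha>1 - \<alpha>2)"
    using False by (simp add: power2_eq_square flip: mult.assoc)
  then show ?thesis using \<open>c > 0\<close> by (simp add: field_simps)
qed

text \<open>Testing strong convexity at the origin gives c |y|^2 \<le> \<alpha>(y). This keeps the
  maximisers in a fixed ball while \<alpha> stays bounded.\<close>

lemma strongly_convex_subgradient_bound:
  assumes "c > 0" and "strongly_convex_at_rate c g" and "\<alpha> \<in> subdifferential g y"
    and min: "g 0 \<le> g y"
  shows "norm y \<le> norm \<alpha> / c"
proof (cases "y = 0")
  case False
  have "c * (norm y)\<^sup>2 \<le> blinfun_apply \<alpha> y"
    using strongly_convex_at_rateD[OF assms(2,3), of 0] min by (simp add: blinfun.minus_right)
  also have "\<dots> \<le> norm \<alpha> * norm y"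
    using norm_blinfun[of \<alpha> y] by simp
  finally show ?thesis
    using False \<open>c > 0\<close> by (simp add: power2_eq_square field_simps)
qed (use \<open>c > 0\<close> in simp)

text \<open>Envelope argument: a quarter of the squared dual norm is the convex conjugate of F^2,
  whose gradient is the maximiser. The remainder is quadratic in |\<beta> - \<alpha>| because
  \<open>Y\<close> is Lipschitz with constant 1/(2c).\<close>

lemma has_derivative_dual_square:
  fixes F :: "'b \<Rightarrow> 'a::euclidean_space \<Rightarrow> real"
  assumes N: "asymmetric_norm (F x)"
    and "c > 0" and sc: "strongly_convex_at_rate c (\<lambda>v. (F x v)\<^sup>2)"
    and sub: "\<And>\<beta>. \<beta> \<in> subdifferential (\<lambda>v. (F x v)\<^sup>2) (Y \<beta>)"
  shows "((\<lambda>\<beta>. (dual_family F x \<beta>)\<^sup>2) has_derivative (\<lambda>\<beta>. blinfun_apply \<beta> (4 *\<^sub>R Y \<alpha>))) (at \<alpha>)"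
proof (rule has_derivativeI_sandwich[of 1])
  show "bounded_linear (\<lambda>\<beta>. blinfun_apply \<beta> (4 *\<^sub>R Y \<alpha>))"
    by (rule blinfun.bounded_linear_left)
  show "((\<lambda>\<beta>. 2 / c * norm (\<beta> - \<alpha>)) \<longlongrightarrow> 0) (at \<alpha>)"
    by (intro tendsto_mult_right_zero tendsto_norm_zero LIM_zero tendsto_ident_at)
  fix \<beta> assume "\<beta> \<noteq> \<alpha>"
  define g where "g = (\<lambda>v. (F x v)\<^sup>2)"
  define D where "D = (dual_family F x \<beta>)\<^sup>2 - (dual_family F x \<alpha>)\<^sup>2 - blinfun_apply (\<beta> - \<alpha>) (4 *\<^sub>R Y \<alpha>)"
  have D: "D = 4 * ((blinfun_apply \<beta> (Y \<beta>) - g (Y \<beta>)) - (blinfun_apply \<alpha> (Y \<alpha>) - g (Y \<alpha>))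
      - blinfun_apply (\<beta> - \<alpha>) (Y \<alpha>))"
    by (simp add: D_def g_def dual_square_eq[where F=F, OF N sub] blinfun.scaleR_right)
  have ge: "g z \<ge> g (Y \<gamma>) + blinfun_apply \<gamma> (z - Y \<gamma>)" for \<gamma> z
    using sub[of \<gamma>] by (simp add: subdifferential_def g_def)
  \<comment> \<open>The maximality of \<open>Y \<beta>\<close>, tested at \<open>Y \<alpha>\<close>,
    bounds the remainder below; exchanging the roles bounds it above.\<close>
  have "D \<ge> 0"
    using ge[of \<beta> "Y \<alpha>"] by (simp add: D blinfun.diff_left blinfun.diff_right)
  moreover have "D \<le> 4 * blinfun_apply (\<beta> - \<alpha>) (Y \<beta> - Y \<alpha>)"
    using ge[of \<alpha> "Y \<beta>"] by (simp add: D blinfun.diff_left blinfun.diff_right)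
  moreover have "blinfun_apply (\<beta> - \<alpha>) (Y \<beta> - Y \<alpha>) \<le> norm (\<beta> - \<alpha>) * norm (Y \<beta> - Y \<alpha>)"
    using norm_blinfun[of "\<beta> - \<alpha>" "Y \<beta> - Y \<alpha>"] by simp
  moreover have "norm (Y \<beta> - Y \<alpha>) \<le> norm (\<beta> - \<alpha>) / (2 * c)"
    using strongly_convex_subgradient_distance[OF \<open>c > 0\<close> sc sub sc sub, of \<beta> \<alpha> 0]
    by (simp add: norm_minus_commute)
  then have "norm (\<beta> - \<alpha>) * norm (Y \<beta> - Y \<alpha>) \<le> norm (\<beta> - \<alpha>) * (norm (\<beta> - \<alpha>) / (2 * c))"
    by (intro mult_left_mono) auto
  ultimately have "norm D \<le> 4 * (norm (\<beta> - \<alpha>) * (norm (\<beta> - \<alpha>) / (2 * c)))"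
    by simp
  then have "norm D / norm (\<beta> - \<alpha>) \<le> 2 / c * norm (\<beta> - \<alpha>)"
    using \<open>\<beta> \<noteq> \<alpha>\<close> \<open>c > 0\<close> by (simp add: field_simps)
  then show "norm ((dual_family F x \<beta>)\<^sup>2 - (dual_family F x \<alpha>)\<^sup>2 - blinfun_apply (\<beta> - \<alpha>) (4 *\<^sub>R Y \<alpha>))
      / norm (\<beta> - \<alpha>) \<le> 2 / c * norm (\<beta> - \<alpha>)"
    by (simp add: D_def)
qed simp

lemma d_v_eqI:
  fixes G :: "'b \<Rightarrow> ('a::euclidean_space \<Rightarrow>\<^sub>L real) \<Rightarrow> real"
  assumes "(G x has_derivative (\<lambda>\<beta>. blinfun_apply \<beta> v)) (at \<alpha>)"
  shows "d_v G x \<alpha> = v"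
  unfolding d_v_def
proof (rule the_equality, rule assms)
  fix w assume "(G x has_derivative (\<lambda>\<beta>. blinfun_apply \<beta> w)) (at \<alpha>)"
  then have "(\<lambda>\<beta>::'a \<Rightarrow>\<^sub>L real. blinfun_apply \<beta> w) = (\<lambda>\<beta>. blinfun_apply \<beta> v)"
    using has_derivative_unique assms by blast
  \<comment> \<open>Functionals separate points: the inner product with w - v tells w from
    v.\<close>
  then have "blinfun_inner_right (w - v) w = blinfun_inner_right (w - v) v"
    by metis
  then have "(w - v) \<bullet> (w - v) = 0"
    by (simp only: blinfun_inner_right.rep_eq inner_diff_right[of "w - v"])
  then show "w = v"
    by simp
qed

section \<open>Lipschitz estimates from partial derivatives\<close>

text \<open>Pass from y to x by changing one coordinate at a time and apply the mean value
  inequality to each of the n segments. A box contains every intermediate point of such a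
  path.\<close>

lemma bounded_partials_imp_lipschitz_cbox:
  fixes f :: "real ^ 'n::finite \<Rightarrow> real" and B :: real
  assumes ex: "\<And>i u. u \<in> cbox a b \<Longrightarrow> partial_exists f (axis i 1) u"
    and bd: "\<And>i u. u \<in> cbox a b \<Longrightarrow> \<bar>partial f (axis i 1) u\<bar> \<le> B"
    and "x \<in> cbox a b" "y \<in> cbox a b"
  shows "\<bar>f x - f y\<bar> \<le> CARD('n) * B * norm (x - y)"
proof -
  \<comment> \<open>The corner of the path at which exactly the coordinates in \<open>S\<close> have
    been switched from y to x.\<close>
  define w :: "'n set \<Rightarrow> real ^ 'n" where "w S = (\<chi> i. if i \<in> S then x $ i else y $ i)" for S
  have xy: "\<And>i. a $ i \<le> x $ i \<and> x $ i \<le> b $ i" "\<And>i. a $ i \<le> y $ i \<and> y $ i \<le> b $ i"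
    using assms(3,4) by (auto simp: mem_box_cart)
  have "B \<ge> 0" using bd[OF assms(3)] abs_ge_zero order_trans by blast
  have "\<bar>f (w S) - f y\<bar> \<le> card S * B * norm (x - y)" if "finite S" for S
    using that
  proof (induction S)
    case empty
    have "w {} = y" by (simp add: w_def vec_eq_iff)
    then show ?case by simp
  next
    case (insert k S)
    define d where "d = x $ k - y $ k"
    define \<phi> where "\<phi> t = f (w S + t *\<^sub>R axis k 1)" for t
    have w_insert: "w (insert k S) = w S + d *\<^sub>R axis k 1"
      using insert.hyps by (auto simp: w_def vec_eq_iff d_def axis_def)
    have in_box: "w S + t *\<^sub>R axis k 1 \<in> cbox a b" if t: "t \<in> closed_segment 0 d" for t
    proof -
      have "a $ k \<le> y $ k + t \<and> y $ k + t \<le> b $ k"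
        using t xy[of k] by (auto simp: closed_segment_eq_real_ivl d_def split: if_splits)
      then show ?thesis
        using xy insert.hyps by (auto simp: mem_box_cart w_def axis_def)
    qed
    have "norm (\<phi> d - \<phi> 0) \<le> B * norm (d - 0)"
    proof (rule field_differentiable_bound)
      fix t assume t: "t \<in> closed_segment 0 d"
      let ?u = "w S + t *\<^sub>R axis k 1"
      \<comment> \<open>The point 0 is written t + - t so that \<open>DERIV_shift\<close> carries
        the derivative from 0 to t.\<close>
      have "((\<lambda>s. f (?u + s *\<^sub>R axis k 1)) has_real_derivative partial f (axis k 1) ?u) (at (t + - t))"
        using ex[OF in_box[OF t], of k]
        by (simp add: partial_exists_def partial_def DERIV_deriv_iff_field_differentiable)
      then have "(\<phi> has_real_derivative partial f (axis k 1) ?u) (at t)"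
        unfolding DERIV_shift by (simp add: \<phi>_def[abs_def] algebra_simps)
      then show "(\<phi> has_real_derivative partial f (axis k 1) ?u) (at t within closed_segment 0 d)"
        by (rule has_field_derivative_at_within)
      show "norm (partial f (axis k 1) ?u) \<le> B"
        using bd[OF in_box[OF t], of k] by simp
    qed auto
    also have "B * norm (d - 0) \<le> B * norm (x - y)"
      using component_le_norm_cart[of "x - y" k] \<open>B \<ge> 0\<close> by (intro mult_left_mono) (auto simp: d_def)
    finally have "\<bar>f (w (insert k S)) - f (w S)\<bar> \<le> B * norm (x - y)"
      by (simp add: \<phi>_def w_insert)
    then show ?case
      using insert by (simp add: algebra_simps)
  qed
  from this[of UNIV] show ?thesis
    by (simp add: w_def)
qed

lemma locally_lipschitz_on_imp_continuous_on:
  assumes "locally_lipschitz_on S f"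
  shows "continuous_on S f"
  unfolding continuous_on_eq_continuous_within
proof
  fix p assume p: "p \<in> S"
  then obtain e L where e: "e > 0" and L: "L-lipschitz_on (ball p e \<inter> S) f"
    using assms unfolding locally_lipschitz_on_def by blast
  have "continuous (at p within ball p e \<inter> S) f"
    using lipschitz_on_continuous_on[OF L] p e
    by (auto simp: continuous_on_eq_continuous_within)
  moreover have "at p within ball p e \<inter> S = at p within S"
    by (rule at_within_nhd[of p "ball p e"]) (use e in auto)
  ultimately show "continuous (at p within S) f"
    by simp
qed

text \<open>Joint local Lipschitz continuity bounds the variation in the second variable locally
  uniformly in the first; compactness of both factors makes the constant global.\<close>

lemma locally_lipschitz_on_compact_uniform:
  fixes f :: "'a::metric_space \<Rightarrow> 'b::metric_space \<Rightarrow> 'c::metric_space"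
  assumes loc: "locally_lipschitz_on (S \<times> S') (\<lambda>(x, y). f x y)"
    and "compact K" "K \<subseteq> S" "compact K'" "K' \<subseteq> S'"
  obtains L where "\<And>x. x \<in> K \<Longrightarrow> L-lipschitz_on K' (f x)"
proof (rule local_lipschitz_compact_implies_lipschitz[of K K' f])
  show "local_lipschitz K K' f"
  proof (rule local_lipschitzI)
    fix x y assume xy: "x \<in> K" "y \<in> K'"
    then have "(x, y) \<in> S \<times> S'" using assms by auto
    then obtain e L where e: "e > 0" and L: "L-lipschitz_on (ball (x, y) e \<inter> S \<times> S') (\<lambda>(x, y). f x y)"
      using loc unfolding locally_lipschitz_on_def by blast
    \<comment> \<open>Two radii of e/3 add up to less than e, so the product of the two balls lies
      in the ball around (x, y).\<close>
    have "L-lipschitz_on (cball y (e/3) \<inter> K') (f u)" if u: "u \<in> cball x (e/3) \<inter> K" for u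
    proof (rule lipschitz_onI)
      show "L \<ge> 0" using L by (rule lipschitz_on_nonneg)
      fix v w assume vw: "v \<in> cball y (e/3) \<inter> K'" "w \<in> cball y (e/3) \<inter> K'"
      have mem: "(u, z) \<in> ball (x, y) e \<inter> S \<times> S'" if "z \<in> cball y (e/3) \<inter> K'" for z
      proof -
        have "dist (x, y) (u, z) \<le> dist x u + dist y z"
          by (simp add: dist_Pair_Pair sqrt_sum_squares_le_sum)
        then show ?thesis using u that assms(3,5) e by auto
      qed
      show "dist (f u v) (f u w) \<le> L * dist v w"
        using lipschitz_onD[OF L mem[OF vw(1)] mem[OF vw(2)]] by (simp add: dist_Pair_Pair)
    qed
    then show "\<exists>u>0. \<exists>L. \<forall>t\<in>cball x u \<inter> K. L-lipschitz_on (cball y u \<inter> K') (f t)"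
      using e by (intro exI[of _ "e/3"] conjI exI[of _ L]) auto
  qed
  fix y assume "y \<in> K'"
  have "continuous_on K ((\<lambda>(x, y). f x y) \<circ> (\<lambda>x. (x, y)))"
    using assms \<open>y \<in> K'\<close>
    by (intro continuous_on_compose continuous_intros
        continuous_on_subset[OF locally_lipschitz_on_imp_continuous_on[OF loc]]) auto
  then show "continuous_on K (\<lambda>x. f x y)" by (simp add: o_def)
qed (use assms that in auto)

lemma blinfun_apply_d_h_axis: "blinfun_apply (d_h G x y) (axis i 1) = hpartial i G x y"
  by (simp add: d_h_def blinfun.sum_left blinfun.scaleR_left inner_axis_axis if_distrib cong: if_cong)

section \<open>Lipschitz dependence of the maximiser on base point and covector\<close>

theorem theorem6p16:
  fixes U U' :: "(real ^ 'n::finite) set"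
    and F F' :: "real ^ 'n \<Rightarrow> real ^ 'n \<Rightarrow> real"
  assumes "open U" and "open U'" and "compactly_contained U U'"
    and "smooth_family U' F'"
    and "horizontally_C2_family U' F"
    and "strongly_convex_wrt U' F F'"
    and "locally_lipschitz_on (U' \<times> UNIV) (\<lambda>(x, y). d_h (\<lambda>x y. (F x y)\<^sup>2) x y)"
  shows "(\<forall>x\<in>U. \<forall>\<alpha>. (\<lambda>\<beta>. (dual_family F x \<beta>)\<^sup>2) differentiable (at \<alpha>)) \<and>
         locally_lipschitz_on (U \<times> UNIV) (\<lambda>(x, \<alpha>). d_v (\<lambda>x \<beta>. (dual_family F x \<beta>)\<^sup>2) x \<alpha>)"
proof -
  define G where "G x y = (F x y)\<^sup>2" for x y
  have "U \<subseteq> U'"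
    using assms(3) closure_subset[of U] by (auto simp: compactly_contained_def)
  have C1: "horizontally_C1_family U' F"
    using assms(5) by (simp add: horizontally_C2_family_def)
  have N: "asymmetric_norm (F x)" if "x \<in> U'" for x
    using C1 that by (simp add: horizontally_C1_family_def)
  have N': "asymmetric_norm (F' x)" if "x \<in> U'" for x
    using assms(4) that by (simp add: smooth_family_def)
  have contF: "continuous_on (U' \<times> UNIV) (\<lambda>(x, y). F x y)"
    using C1 by (simp add: horizontally_C1_family_def)
  have contF': "continuous_on (U' \<times> (UNIV - {0})) (\<lambda>(x, y). F' x y)"
    using assms(4) unfolding smooth_family_def Cinf_on_def by (metis Ck_on.simps(1))
  have partial_G: "partial_exists (\<lambda>u. G u y) (axis i 1) x" if "x \<in> U'" for x y i
    using C1 that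
    by (auto simp: horizontally_C1_family_def hpartial_exists_def partial_exists_def G_def
        intro!: field_differentiable_power)

  have "\<exists>y. \<alpha> \<in> subdifferential (G x) y" if x: "x \<in> U'" for x \<alpha>
  proof -
    have cont: "continuous_on ({x} \<times> (UNIV - {0})) (\<lambda>(x, y). F x y)"
      using x by (intro continuous_on_subset[OF contF]) auto
    obtain m where m: "m > 0" "\<And>u y. u \<in> {x} \<Longrightarrow> m * norm y \<le> F u y"
      by (rule asymmetric_norm_lower_bound[OF _ _ cont]) (use N[OF x] in auto)
    have "continuous_on UNIV ((\<lambda>(x, y). F x y) \<circ> Pair x)"
      using x by (intro continuous_on_compose continuous_intros continuous_on_subset[OF contF]) auto
    then have "continuous_on UNIV (F x)" by (simp add: o_def)
    moreover have "m * norm y \<le> F x y" for y using m(2) by simp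
    moreover have "F x 0 = 0" using N[OF x] by (simp add: asymmetric_norm_def)
    ultimately obtain y where "\<alpha> \<in> subdifferential (\<lambda>v. (F x v)\<^sup>2) y"
      by (rule subdifferential_square_surj[OF _ m(1)])
    then show ?thesis by (auto simp: G_def[abs_def])
  qed
  \<comment> \<open>\<open>Y x \<alpha>\<close> is the maximiser of \<alpha> - F^2; four times it
    will be the vertical differential.\<close>
  then obtain Y where Y: "\<And>x \<alpha>. x \<in> U' \<Longrightarrow> \<alpha> \<in> subdifferential (G x) (Y x \<alpha>)"
    by metis
  \<comment> \<open>On a compact set \<open>F'\<close> dominates m times the Euclidean norm, which
    gives the rate m^2.\<close>
  have rate: "\<exists>c>0. \<forall>x\<in>K. strongly_convex_at_rate c (G x)" if K: "compact K" "K \<subseteq> U'" for K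
  proof -
    have "continuous_on (K \<times> (UNIV - {0})) (\<lambda>(x, y). F' x y)"
      using K by (intro continuous_on_subset[OF contF']) auto
    then obtain m where m: "m > 0" "\<And>x y. x \<in> K \<Longrightarrow> m * norm y \<le> F' x y"
      using asymmetric_norm_lower_bound[of K F'] N' K by blast
    have "strongly_convex_at_rate (m\<^sup>2) (G x)" if x: "x \<in> K" for x
      unfolding strongly_convex_at_rate_def
    proof (intro allI ballI)
      fix y z \<alpha> assume "\<alpha> \<in> subdifferential (G x) y"
      then have "G x z \<ge> G x y + blinfun_apply \<alpha> (z - y) + (F' x (z - y))\<^sup>2"
        using assms(6) x K by (auto simp: strongly_convex_wrt_def G_def[abs_def])
      moreover have "(m * norm (z - y))\<^sup>2 \<le> (F' x (z - y))\<^sup>2"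
        using m x by (intro power_mono) auto
      ultimately show "G x z \<ge> G x y + blinfun_apply \<alpha> (z - y) + m\<^sup>2 * (norm (z - y))\<^sup>2"
        by (simp add: power_mult_distrib)
    qed
    then show ?thesis using m(1) by (intro exI[of _ "m\<^sup>2"]) auto
  qed
  have deriv: "((\<lambda>\<beta>. (dual_family F x \<beta>)\<^sup>2) has_derivative (\<lambda>\<beta>. blinfun_apply \<beta> (4 *\<^sub>R Y x \<alpha>))) (at \<alpha>)"
    if x: "x \<in> U'" for x \<alpha>
  proof -
    obtain c where "c > 0" "strongly_convex_at_rate c (G x)"
      using rate[of "{x}"] x by auto
    then show ?thesis
      using has_derivative_dual_square[of F x c "Y x"] N[OF x] Y[OF x] by (simp add: G_def[abs_def])
  qed
  have d_v_eq: "d_v (\<lambda>x \<beta>. (dual_family F x \<beta>)\<^sup>2) x \<alpha> = 4 *\<^sub>R Y x \<alpha>" if "x \<in> U'" for x \<alpha>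
    using deriv[OF that] by (rule d_v_eqI)

  have "locally_lipschitz_on (U \<times> UNIV) (\<lambda>(x, \<alpha>). d_v (\<lambda>x \<beta>. (dual_family F x \<beta>)\<^sup>2) x \<alpha>)"
    unfolding locally_lipschitz_on_def
  proof (rule ballI)
    fix p :: "(real ^ 'n) \<times> ((real ^ 'n) \<Rightarrow>\<^sub>L real)" assume "p \<in> U \<times> UNIV"
    then obtain x0 \<alpha>0 where p: "p = (x0, \<alpha>0)" and "x0 \<in> U'"
      using \<open>U \<subseteq> U'\<close> by auto
    \<comment> \<open>A compact box gives uniform constants and admits coordinatewise paths between
      base points.\<close>
    obtain a b where ab: "cbox a b \<subseteq> U'" "x0 \<in> box a b" "\<forall>i\<in>Basis. a \<bullet> i < b \<bullet> i"
      by (rule open_contains_cbox[OF \<open>open U'\<close> \<open>x0 \<in> U'\<close>])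
    obtain r where r: "r > 0" "ball x0 r \<subseteq> box a b"
      using ab(2) open_box[of a b] unfolding open_contains_ball by blast
    obtain c where c: "c > 0" "\<And>x. x \<in> cbox a b \<Longrightarrow> strongly_convex_at_rate c (G x)"
      using rate[OF compact_cbox ab(1)] by blast
    \<comment> \<open>Bounds every \<open>Y x \<alpha>\<close> with x in the box and |\<alpha>|
      \<le> |\<alpha>0| + 1.\<close>
    define R where "R = (norm \<alpha>0 + 1) / c"
    obtain L where L: "\<And>x. x \<in> cbox a b \<Longrightarrow> L-lipschitz_on (cball 0 R) (d_h G x)"
      using locally_lipschitz_on_compact_uniform[OF assms(7) compact_cbox ab(1) compact_cball[of 0 R]]
      by (auto simp: G_def[abs_def])
    have "L \<ge> 0" using lipschitz_on_nonneg[OF L] ab(2) box_subset_cbox by blast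
    \<comment> \<open>The bound r keeps x in the box; the bound 1 keeps |\<alpha>| below |\<alpha>0|
      + 1.\<close>
    define e where "e = min r 1"
    have "e > 0" using r by (simp add: e_def)
    \<comment> \<open>The factor 4 comes from \<open>d_v_eq\<close>, the quotient from the
      subgradient distance with B = n L |x1 - x2|.\<close>
    let ?M = "4 * ((CARD('n) * L + 1) / (2 * c))"
    have near: "x \<in> cbox a b" "norm (Y x \<alpha>) \<le> R" if "(x, \<alpha>) \<in> ball p e" for x \<alpha>
    proof -
      have "dist x0 x \<le> dist p (x, \<alpha>)" "dist \<alpha>0 \<alpha> \<le> dist p (x, \<alpha>)"
        using dist_fst_le[of p "(x, \<alpha>)"] dist_snd_le[of p "(x, \<alpha>)"] by (auto simp: p)
      then have d: "dist x0 x < r" "dist \<alpha>0 \<alpha> < 1"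
        using that by (auto simp: e_def)
      then show x: "x \<in> cbox a b" using r(2) box_subset_cbox[of a b] by auto
      then have "x \<in> U'" using ab(1) by auto
      then have "G x 0 = 0" using N by (simp add: G_def asymmetric_norm_def)
      then have "norm (Y x \<alpha>) \<le> norm \<alpha> / c"
        using strongly_convex_subgradient_bound[OF c(1) c(2)[OF x] Y[OF \<open>x \<in> U'\<close>]] by (simp add: G_def)
      also have "norm \<alpha> \<le> norm \<alpha>0 + 1"
        using d(2) norm_triangle_sub[of \<alpha> \<alpha>0] by (simp add: dist_norm norm_minus_commute)
      then have "norm \<alpha> / c \<le> R" using c(1) by (simp add: R_def divide_right_mono)
      finally show "norm (Y x \<alpha>) \<le> R" .
    qed
    have "?M-lipschitz_on (ball p e \<inter> U \<times> UNIV) (\<lambda>(x, \<alpha>). d_v (\<lambda>x \<beta>. (dual_family F x \<beta>)\<^sup>2) x \<alpha>)"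
    proof (rule lipschitz_onI)
      show "?M \<ge> 0" using \<open>L \<ge> 0\<close> c(1) by simp
      fix q1 q2 assume q: "q1 \<in> ball p e \<inter> U \<times> UNIV" "q2 \<in> ball p e \<inter> U \<times> UNIV"
      obtain x1 \<alpha>1 x2 \<alpha>2 where q_eq: "q1 = (x1, \<alpha>1)" "q2 = (x2, \<alpha>2)"
        by (metis surj_pair)
      have x: "x1 \<in> cbox a b" "x2 \<in> cbox a b" and y: "norm (Y x1 \<alpha>1) \<le> R" "norm (Y x2 \<alpha>2) \<le> R"
        using near q q_eq by auto
      have U': "x1 \<in> U'" "x2 \<in> U'" using x ab(1) by auto
      define y1 y2 where "y1 = Y x1 \<alpha>1" and "y2 = Y x2 \<alpha>2"
      \<comment> \<open>With both vectors frozen, the partials in u are components of a difference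
        of \<open>d_h G\<close> at \<open>y2\<close> and \<open>y1\<close>. The Lipschitz bound in
        the fibre thus supplies the factor |y2 - y1|, and integration over the box the factor |x1 -
        x2|.\<close>
      let ?f = "\<lambda>u. G u y2 - G u y1"
      have partial: "partial_exists ?f (axis i 1) u \<and> \<bar>partial ?f (axis i 1) u\<bar> \<le> L * norm (y2 - y1)"
        if u: "u \<in> cbox a b" for u i
      proof
        have ex: "partial_exists (\<lambda>u. G u y) (axis i 1) u" for y
          using partial_G u ab(1) by blast
        then show "partial_exists ?f (axis i 1) u"
          by (auto simp: partial_exists_def intro!: field_differentiable_diff)
        have "partial ?f (axis i 1) u = hpartial i G u y2 - hpartial i G u y1"
          using ex by (simp add: partial_exists_def partial_def hpartial_def)
        also have "\<dots> = blinfun_apply (d_h G u y2 - d_h G u y1) (axis i 1)"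
          by (simp add: blinfun.diff_left blinfun_apply_d_h_axis)
        also have "\<bar>\<dots>\<bar> \<le> norm (d_h G u y2 - d_h G u y1)"
          using norm_blinfun[of "d_h G u y2 - d_h G u y1" "axis i 1"] by simp
        also have "\<dots> \<le> L * norm (y2 - y1)"
          using lipschitz_onD[OF L[OF u], of y2 y1] y by (simp add: dist_norm y1_def y2_def)
        finally show "\<bar>partial ?f (axis i 1) u\<bar> \<le> L * norm (y2 - y1)" .
      qed
      have "\<bar>?f x1 - ?f x2\<bar> \<le> CARD('n) * (L * norm (y2 - y1)) * norm (x1 - x2)"
        by (rule bounded_partials_imp_lipschitz_cbox[where f = ?f]) (use partial x in auto)
      then have "norm (y2 - y1) \<le> (CARD('n) * L * norm (x1 - x2) + norm (\<alpha>1 - \<alpha>2)) / (2 * c)"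
        using \<open>L \<ge> 0\<close> unfolding y1_def y2_def
        by (intro strongly_convex_subgradient_distance[of c "G x1" _ _ "G x2"] c x Y U')
           (auto simp: mult_ac)
      also have "\<dots> \<le> (CARD('n) * L + 1) * dist q1 q2 / (2 * c)"
      proof (rule divide_right_mono)
        have "norm (x1 - x2) \<le> dist q1 q2" "norm (\<alpha>1 - \<alpha>2) \<le> dist q1 q2"
          using dist_fst_le[of q1 q2] dist_snd_le[of q1 q2] by (auto simp: q_eq dist_norm)
        then have "CARD('n) * L * norm (x1 - x2) + norm (\<alpha>1 - \<alpha>2) \<le> CARD('n) * L * dist q1 q2 + dist q1 q2"
          using \<open>L \<ge> 0\<close> by (intro add_mono mult_left_mono) auto
        then show "CARD('n) * L * norm (x1 - x2) + norm (\<alpha>1 - \<alpha>2) \<le> (CARD('n) * L + 1) * dist q1 q2"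
          by (simp add: algebra_simps)
      qed (use c(1) in simp)
      finally have "norm (y2 - y1) \<le> (CARD('n) * L + 1) * dist q1 q2 / (2 * c)" .
      from mult_left_mono[OF this, of 4] have "4 * norm (y2 - y1) \<le> ?M * dist q1 q2"
        by (simp only: times_divide_eq_left times_divide_eq_right mult.assoc)
      moreover have "dist (4 *\<^sub>R y1) (4 *\<^sub>R y2) = 4 * norm (y2 - y1)"
        by (simp add: dist_norm norm_minus_commute flip: scaleR_diff_right)
      ultimately show "dist ((\<lambda>(x, \<alpha>). d_v (\<lambda>x \<beta>. (dual_family F x \<beta>)\<^sup>2) x \<alpha>) q1)
          ((\<lambda>(x, \<alpha>). d_v (\<lambda>x \<beta>. (dual_family F x \<beta>)\<^sup>2) x \<alpha>) q2) \<le> ?M * dist q1 q2"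
        by (simp add: q_eq d_v_eq[OF U'(1)] d_v_eq[OF U'(2)] y1_def y2_def)
    qed
    then show "\<exists>e>0. \<exists>L. L-lipschitz_on (ball p e \<inter> U \<times> UNIV)
        (\<lambda>(x, \<alpha>). d_v (\<lambda>x \<beta>. (dual_family F x \<beta>)\<^sup>2) x \<alpha>)"
      using \<open>e > 0\<close> by blast
  qed
  moreover have "\<forall>x\<in>U. \<forall>\<alpha>. (\<lambda>\<beta>. (dual_family F x \<beta>)\<^sup>2) differentiable (at \<alpha>)"
    using deriv \<open>U \<subseteq> U'\<close> unfolding differentiable_def by blast
  ultimately show ?thesis by blast
qed

end
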